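(* For every well-quasi-order $A$, $$1+\mathbf{o}(A)\;\le\;\mathbf{o}(\mathcal{P}_f(A))\;\le\;2^{\mathbf{o}(A)},$$ where the exponentiation is ordinal exponentiation.
   Context: A quasi-order $(A,\le)$ is a well-quasi-order (wqo) if every infinite sequence $x_0,x_1,\dots$ in $A$ has indices $i<j$ with $x_i\le x_j$. For a wqo $A$, let $\mathrm{Bad}(A)$, $\mathrm{Dec}(A)$, $\mathrm{Inco}(A)$ be the trees of finite bad sequences (sequences with no $i<j$, $x_i\le x_j$), finite strictly decreasing sequences, and finite sequences of pairwise incomparable elements of $A$, respectively; the root is the empty sequence and the children of a sequence are its one-element extensions. These trees are well-founded; the rank of a node $s$ is $r(s)=\sup\{r(t)+1 : t \text{ a child of } s\}$ (so $0$ for leaves). The maximal order type $\mathbf{o}(A)$, height $\mathbf{h}(A)$ and width $\mathbf{w}(A)$ are the ranks of the roots of $\mathrm{Bad}(A)$, $\mathrm{Dec}(A)$, $\mathrm{Inco}(A)$ respectively. $\mathcal{P}_f(A)$ denotes the set of finite subsets of $A$ ordered by the Hoare embedding: $S\le_H S'$ iff for every $a\in S$ there is $b\in S'$ with $a\le b$; it is a wqo when $A$ is. *)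

theory Defs
  imports Main
begin

definition qo_on :: "'a set \<Rightarrow> ('a \<Rightarrow> 'a \<Rightarrow> bool) \<Rightarrow> bool" where
  "qo_on A le \<longleftrightarrow> (\<forall>x\<in>A. le x x) \<and> (\<forall>x\<in>A. \<forall>y\<in>A. \<forall>z\<in>A. le x y \<longrightarrow> le y z \<longrightarrow> le x z)"

definition wqo_on :: "'a set \<Rightarrow> ('a \<Rightarrow> 'a \<Rightarrow> bool) \<Rightarrow> bool" where
  "wqo_on A le \<longleftrightarrow> qo_on A le \<and>
     (\<forall>f::nat \<Rightarrow> 'a. (\<forall>i. f i \<in> A) \<longrightarrow> (\<exists>i j. i < j \<and> le (f i) (f j)))"

definition Pf :: "'a set \<Rightarrow> 'a set set" where
  "Pf A = {S. finite S \<and> S \<subseteq> A}"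

definition hoare :: "('a \<Rightarrow> 'a \<Rightarrow> bool) \<Rightarrow> 'a set \<Rightarrow> 'a set \<Rightarrow> bool" where
  "hoare le S S' \<longleftrightarrow> (\<forall>a\<in>S. \<exists>b\<in>S'. le a b)"

definition bad_seq :: "('a \<Rightarrow> 'a \<Rightarrow> bool) \<Rightarrow> 'a list \<Rightarrow> bool" where
  "bad_seq le xs \<longleftrightarrow> (\<forall>i j. i < j \<and> j < length xs \<longrightarrow> \<not> le (xs ! i) (xs ! j))"

definition Bad :: "'a set \<Rightarrow> ('a \<Rightarrow> 'a \<Rightarrow> bool) \<Rightarrow> 'a list set" where
  "Bad A le = {xs. set xs \<subseteq> A \<and> bad_seq le xs}"

definition child :: "'a list \<Rightarrow> 'a list \<Rightarrow> bool" where
  "child s t \<longleftrightarrow> (\<exists>x. t = s @ [x])"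

text \<open>A rank function on a tree with node set N: for every node s, rank s is the
  least ordinal strictly above rank t for all children t, i.e. sup {rank t + 1}.
  Ordinals are represented by well-order relations on the node type, which is
  large enough to carry every rank.\<close>

definition is_rank_fun :: "'n set \<Rightarrow> ('n \<Rightarrow> 'n \<Rightarrow> bool) \<Rightarrow> ('n \<Rightarrow> 'n rel) \<Rightarrow> bool" where
  "is_rank_fun N ch \<rho> \<longleftrightarrow>
     (\<forall>s\<in>N. Well_order (\<rho> s) \<and>
        (\<forall>t\<in>N. ch s t \<longrightarrow> (\<rho> t, \<rho> s) \<in> ordLess) \<and>
        (\<forall>w :: 'n rel. Well_order w \<and> (\<forall>t\<in>N. ch s t \<longrightarrow> (\<rho> t, w) \<in> ordLess) \<longrightarrow> (\<rho> s, w) \<in> ordLeq))"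

definition node_rank :: "'n set \<Rightarrow> ('n \<Rightarrow> 'n \<Rightarrow> bool) \<Rightarrow> 'n \<Rightarrow> 'n rel" where
  "node_rank N ch s = (SOME \<rho>. is_rank_fun N ch \<rho>) s"

definition max_otype :: "'a set \<Rightarrow> ('a \<Rightarrow> 'a \<Rightarrow> bool) \<Rightarrow> 'a list rel" where
  "max_otype A le = node_rank (Bad A le) child []"

definition one_plus :: "'a rel \<Rightarrow> (unit + 'a) rel" where
  "one_plus w = {(Inl (), Inl ())} \<union> {(Inl (), Inr a) | a. a \<in> Field w}
               \<union> {(Inr a, Inr b) | a b. (a, b) \<in> w}"

text \<open>2^w (ordinal exponentiation): finitely supported functions Field w \<rightarrow> 2,
  i.e. finite subsets of Field w, compared at the w-largest point where they differ.\<close>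

definition oexp2 :: "'a rel \<Rightarrow> 'a set rel" where
  "oexp2 w = {(F, G). finite F \<and> F \<subseteq> Field w \<and> finite G \<and> G \<subseteq> Field w \<and>
                (F = G \<or> (\<exists>b\<in>G - F. \<forall>a\<in>F - G. (a, b) \<in> w))}"

end

(* Upper bound: the residual of Pf(B) after a set S is the union of the Pf({x in B. not a <= x}) over
   a in S, so o(Pf(B)) is controlled by natural sums of the bounds for smaller residuals of A. If
   o(B) is a limit, finitely many ordinals 2^x with x < o(B) have natural sum below 2^o(B). If
   o(B) = y + 1, some a in B has a residual of type y; such an a is maximal up to equivalence, so
   Pf(B) splits into the sets avoiding a and the sets meeting the class of a, and both are
   bounded by 2^y. Writing 2^(l + n) with l limit as 2^n copies of l turns natural sums into
   multiset unions, and the binary digits of the multiplicities give back finite subsets of o(A).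

   Lower bound: bad sequences of elements are bad sequences of singletons, and the empty set can
   always be appended as a last element. *)

theory Submission
  imports Defs "HOL-Library.Multiset_Order" "HOL-Library.Option_ord"
begin

unbundle cardinal_syntax

section \<open>Ordinals as well-orders up to isomorphism\<close>

\<comment> \<open>The quotient is partial because \<open>ordIso\<close> is reflexive only on
  well-orders. Its elements are the ordinals that some subset of the node type can carry; making
  them a \<open>wellorder\<close> type gives access to \<open>LEAST\<close>,
  \<open>less_induct\<close> and the multiset order.\<close>
quotient_type 'n wo = "'n rel" / partial: "\<lambda>r s. (r, s) \<in> ordIso"
proof (rule part_equivpI)
  show "\<exists>x. (x, x) \<in> (ordIso :: ('a rel \<times> 'a rel) set)"
    using card_of_refl by blast
  show "symp (\<lambda>r s. (r, s) \<in> (ordIso :: ('a rel \<times> 'a rel) set))"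
    by (auto intro: sympI ordIso_symmetric)
  show "transp (\<lambda>r s. (r, s) \<in> (ordIso :: ('a rel \<times> 'a rel) set))"
    by (auto intro: transpI ordIso_transitive)
qed

lemma ordIso_refl_iff: "(r, r) \<in> ordIso \<longleftrightarrow> Well_order r"
  using ordIso_reflexive by (auto simp: ordIso_def)

lemma wo_class_exhaust:
  obtains r where "Well_order r" and "x = abs_wo r"
proof -
  have "rep_wo x =o rep_wo x" and "abs_wo (rep_wo x) = x"
    using Quotient3_wo unfolding Quotient3_def by blast+
  then show ?thesis using that[of "rep_wo x"] by (simp add: ordIso_refl_iff)
qed

instantiation wo :: (type) wellorder
begin

lift_definition less_eq_wo :: "'a wo \<Rightarrow> 'a wo \<Rightarrow> bool" is "\<lambda>r s. (r, s) \<in> ordLeq"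
  by (meson ordIso_iff_ordLeq ordLeq_transitive)

lift_definition less_wo :: "'a wo \<Rightarrow> 'a wo \<Rightarrow> bool" is "\<lambda>r s. (r, s) \<in> ordLess"
  by (meson ordIso_ordLess_trans ordIso_symmetric ordLess_ordIso_trans)

instance
proof
  fix x y z :: "'a wo"
  show "x < y \<longleftrightarrow> x \<le> y \<and> \<not> y \<le> x"
    by transfer (metis not_ordLess_ordLeq ordLeq_Well_order_simp ordLess_or_ordLeq ordLess_imp_ordLeq ordIso_refl_iff)
  show "x \<le> x" by transfer (simp add: ordLeq_reflexive ordIso_refl_iff)
  show "x \<le> y \<Longrightarrow> y \<le> z \<Longrightarrow> x \<le> z" by transfer (rule ordLeq_transitive)
  show "x \<le> y \<Longrightarrow> y \<le> x \<Longrightarrow> x = y" by transfer (simp add: ordIso_iff_ordLeq)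
  show "x \<le> y \<or> y \<le> x" by transfer (simp add: ordLeq_total ordIso_refl_iff)
next
  fix P :: "'a wo \<Rightarrow> bool" and a :: "'a wo"
  assume step: "\<And>x. (\<And>y. y < x \<Longrightarrow> P y) \<Longrightarrow> P x"
  have "\<forall>a. Well_order r \<longrightarrow> a = abs_wo r \<longrightarrow> P a" for r :: "'a rel"
  proof (induction r rule: wf_induct[OF wf_ordLess])
    case (1 r)
    show ?case
    proof (intro allI impI)
      fix a assume r: "Well_order r" "a = abs_wo r"
      show "P a"
      proof (rule step)
        fix y assume "y < a"
        obtain s where s: "Well_order s" "y = abs_wo s" by (rule wo_class_exhaust)
        with \<open>y < a\<close> r have "s <o r" by (simp add: less_wo.abs_eq ordIso_refl_iff)
        with 1 s show "P y" by blast
      qed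
    qed
  qed
  then show "P a" by (metis wo_class_exhaust)
qed

end

lemma abs_wo_less_iff: "Well_order r \<Longrightarrow> Well_order s \<Longrightarrow> abs_wo r < abs_wo s \<longleftrightarrow> r <o s"
  and abs_wo_le_iff: "Well_order r \<Longrightarrow> Well_order s \<Longrightarrow> abs_wo r \<le> abs_wo s \<longleftrightarrow> r \<le>o s"
  by (simp_all add: less_wo.abs_eq less_eq_wo.abs_eq ordIso_refl_iff)

text \<open>The ordinal position of a point: \<open>pos_le_iff\<close> and \<open>pos_image\<close>
  identify \<open>Field r\<close> with the ordinals below \<open>abs_wo r\<close>.\<close>

definition pos :: "'n rel \<Rightarrow> 'n \<Rightarrow> 'n wo" where
  "pos r a = abs_wo (Restr r (underS r a))"

lemma Restr_underS_underS:
  assumes "Well_order r" "(a, b) \<in> r" "a \<noteq> b"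
  shows "Restr (Restr r (underS r b)) (underS (Restr r (underS r b)) a) = Restr r (underS r a)"
    and "a \<in> Field (Restr r (underS r b))"
proof -
  have tr: "trans r" and an: "antisym r" and rf: "refl_on (Field r) r"
    using assms(1) unfolding well_order_on_def linear_order_on_def partial_order_on_def preorder_on_def by auto
  have sub: "underS r a \<subseteq> underS r b"
    using assms tr an by (auto simp: underS_def dest: transD antisymD)
  show "Restr (Restr r (underS r b)) (underS (Restr r (underS r b)) a) = Restr r (underS r a)"
    using sub assms by (auto simp: underS_def)
  show "a \<in> Field (Restr r (underS r b))"
    using assms rf by (auto simp: underS_def Field_def refl_on_def)
qed

lemma Restr_underS_less:
  assumes "Well_order r" "(a, b) \<in> r" "a \<noteq> b"
  shows "Restr r (underS r a) <o Restr r (underS r b)"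
proof -
  have W: "Well_order (Restr r X)" for X by (rule Well_order_Restr[OF assms(1)])
  show ?thesis
    using Restr_underS_underS[OF assms] ordIso_reflexive[OF W]
    by (metis W ordLess_iff_ordIso_Restr)
qed

lemma pos_mono:
  assumes "Well_order r" "(a, b) \<in> r" "a \<noteq> b"
  shows "pos r a < pos r b"
  using Restr_underS_less[OF assms] Well_order_Restr[OF assms(1)] by (simp add: pos_def abs_wo_less_iff)

lemma pos_le_iff:
  assumes r: "Well_order r" and "a \<in> Field r" "b \<in> Field r"
  shows "pos r a \<le> pos r b \<longleftrightarrow> (a, b) \<in> r"
proof -
  have "(a, b) \<in> r \<or> (b, a) \<in> r" and "(a, a) \<in> r"
    using assms unfolding well_order_on_def linear_order_on_def partial_order_on_def preorder_on_def
      total_on_def refl_on_def by metis+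
  then show ?thesis using pos_mono[OF r]
    by (metis less_le_not_le order.refl)
qed

lemma pos_image:
  assumes r: "Well_order r"
  shows "pos r ` Field r = {x. x < abs_wo r}"
proof (intro set_eqI iffI)
  fix x assume "x \<in> pos r ` Field r"
  then obtain a where a: "a \<in> Field r" "x = pos r a" by blast
  then have "Restr r (underS r a) <o r" by (intro underS_Restr_ordLess[OF r]) auto
  then show "x \<in> {x. x < abs_wo r}"
    using a Well_order_Restr[OF r] r by (simp add: pos_def abs_wo_less_iff)
next
  fix x assume x: "x \<in> {x. x < abs_wo r}"
  obtain s where s: "Well_order s" "x = abs_wo s" by (rule wo_class_exhaust)
  with x r have "s <o r" by (simp add: abs_wo_less_iff)
  then obtain a where "a \<in> Field r" "s =o Restr r (underS r a)"
    using ordLess_iff_ordIso_Restr[OF r s(1)] by blast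
  moreover have "abs_wo s = abs_wo (Restr r (underS r a))"
    using calculation Quotient3_rel_abs[OF Quotient3_wo] by blast
  ultimately show "x \<in> pos r ` Field r" using s by (auto simp: pos_def)
qed

lemma pos_inj:
  assumes "Well_order r"
  shows "inj_on (pos r) (Field r)"
proof (rule inj_onI)
  fix a b assume "a \<in> Field r" "b \<in> Field r" "pos r a = pos r b"
  moreover have "(a, b) \<in> r" using calculation pos_le_iff[OF assms, of a b] by simp
  ultimately show "a = b" using pos_mono[OF assms, of a b] by auto
qed

text \<open>Pulling a well-order back along an injection. The encodings of \<open>oexp2\<close> into
  multisets and of \<open>one_plus\<close> into options are both fed to this lemma.\<close>

lemma Well_order_inj_wellorder:
  fixes \<phi> :: "'a \<Rightarrow> 'b::wellorder"
  assumes inj: "inj_on \<phi> F" and r: "r = {(x, y). x \<in> F \<and> y \<in> F \<and> \<phi> x \<le> \<phi> y}"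
  shows "Well_order r" and "Field r = F"
proof -
  show F: "Field r = F" unfolding r Field_def by auto
  have "r - Id \<subseteq> inv_image {(x, y). x < y} \<phi>"
  proof
    fix p assume "p \<in> r - Id"
    then obtain x y where p: "p = (x, y)" "x \<in> F" "y \<in> F" "\<phi> x \<le> \<phi> y" "x \<noteq> y"
      unfolding r by blast
    with inj have "\<phi> x \<noteq> \<phi> y" by (meson inj_onD)
    with p show "p \<in> inv_image {(x, y). x < y} \<phi>" by simp
  qed
  then have "wf (r - Id)" using wf_subset wf_inv_image[OF wf] by blast
  moreover have "refl_on F r" unfolding r refl_on_def by auto
  moreover have "trans r" unfolding r trans_def by auto
  moreover have "antisym r" unfolding r antisym_def using inj by (auto dest: inj_onD)
  moreover have "total_on F r" unfolding r total_on_def by auto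
  moreover have "r \<subseteq> F \<times> F" unfolding r by auto
  ultimately show "Well_order r" unfolding F
    by (simp add: well_order_on_def linear_order_on_def partial_order_on_def preorder_on_def)
qed

text \<open>Otherwise \<open>s\<close> would be a proper initial segment of \<open>r\<close>, and
  composing with \<open>f\<close> would give a strictly increasing self-map \<open>k\<close> of
  \<open>r\<close> with \<open>k a\<close> below \<open>a\<close>.\<close>

lemma strict_mono_imp_ordLeq:
  assumes r: "Well_order r" and s: "Well_order s"
    and f: "\<And>a. a \<in> Field r \<Longrightarrow> f a \<in> Field s"
    and mono: "\<And>a b. (a, b) \<in> r \<Longrightarrow> a \<noteq> b \<Longrightarrow> (f a, f b) \<in> s \<and> f a \<noteq> f b"
  shows "r \<le>o s"
proof (rule ccontr)
  assume "\<not> r \<le>o s"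
  then have "s <o r" using ordLess_or_ordLeq[OF s r] by blast
  then obtain a where a: "a \<in> Field r" "s =o Restr r (underS r a)"
    using ordLess_iff_ordIso_Restr[OF r s] by blast
  then obtain g where g: "iso s (Restr r (underS r a)) g" by (auto simp: ordIso_def)
  define k where "k = g \<circ> f"
  have bij: "bij_betw g (Field s) (Field (Restr r (underS r a)))"
    and gm: "\<And>x y. (x, y) \<in> s \<Longrightarrow> (g x, g y) \<in> Restr r (underS r a)"
    using g by (auto simp: iso_iff2 Field_def)
  have ka: "(k x, a) \<in> r - Id" if "x \<in> Field r" for x
  proof -
    have "g (f x) \<in> Field (Restr r (underS r a))" using bij f[OF that] by (auto simp: bij_betw_def)
    then have "g (f x) \<in> underS r a" by (auto simp: Field_def)
    then show ?thesis by (auto simp: k_def underS_def)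
  qed
  have km: "(k x, k y) \<in> r - Id" if "(x, y) \<in> r - Id" for x y
  proof -
    have "(f x, f y) \<in> s" "f x \<noteq> f y" using mono that by auto
    moreover have "f x \<in> Field s" "f y \<in> Field s" using that f by (auto simp: Field_def)
    ultimately show ?thesis using gm[of "f x" "f y"] bij by (auto simp: k_def bij_betw_def inj_on_def)
  qed
  have "wf (r - Id)" using r by (simp add: well_order_on_def)
  \<comment> \<open>If \<open>k x\<close> were below \<open>x\<close>, monotonicity would put
    \<open>k (k x)\<close> below \<open>k x\<close>, against the induction hypothesis at
    \<open>k x\<close>.\<close>
  moreover have "(k x, x) \<notin> r - Id" for x
    using \<open>wf (r - Id)\<close>
  proof (induction x rule: wf_induct_rule)
    case (less x) then show ?case using km by blast
  qed
  ultimately show False using ka[OF a(1)] by blast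
qed

text \<open>A Burali-Forti argument. If \<open>f\<close> were cofinal, \<open>'n wo\<close> would be
  a union of at most |'n| segments, each of size at most |'n|, and so would inject into
  \<open>'n\<close>. The well-order \<open>R\<close> transported there would have a type above every
  \<open>k x\<close>, while the increasing map \<open>k\<close> satisfies
  \<open>x \<le> k x\<close>; taking \<open>x = abs_wo R\<close> is absurd.\<close>

lemma wo_bounded:
  fixes f :: "'n \<Rightarrow> 'n wo"
  assumes inf: "infinite (UNIV :: 'n set)"
  shows "\<exists>x. \<forall>t. f t < x"
proof (rule ccontr)
  assume "\<not> ?thesis"
  then have "\<forall>x. \<exists>t. x \<le> f t" by (meson not_le)
  have card_below: "|{x. x \<le> y}| \<le>o |UNIV :: 'n set|" for y :: "'n wo"
  proof -
    obtain r where r: "Well_order r" "y = abs_wo r" by (rule wo_class_exhaust)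
    have "{x. x \<le> y} = insert y (pos r ` Field r)" using pos_image[OF r(1)] r(2) by auto
    moreover have "|pos r ` Field r| \<le>o |UNIV :: 'n set|"
      by (metis card_of_image card_of_mono1 ordLeq_transitive subset_UNIV)
    moreover have "|{y}| \<le>o |UNIV :: 'n set|" by (simp add: card_of_singl_ordLeq)
    ultimately show ?thesis 
      using card_of_Un_ordLeq_infinite_Field[of "|UNIV :: 'n set|" "{y}" "pos r ` Field r"] inf card_of_Card_order
      by (metis Field_card_of insert_is_Un)
  qed
  have "(\<Union>t. {x. x \<le> f t}) = UNIV" using \<open>\<forall>x. \<exists>t. x \<le> f t\<close> by auto
  then have "|UNIV :: 'n wo set| \<le>o |UNIV :: 'n set|"
    using card_of_UNION_ordLeq_infinite[OF inf, of "UNIV :: 'n set" "\<lambda>t. {x. x \<le> f t}"] card_below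
      card_of_mono1[OF order.refl] by fastforce
  then obtain i :: "'n wo \<Rightarrow> 'n" where i: "inj i" unfolding card_of_ordLeq[symmetric] by auto
  define R where "R = {(a, b). a \<in> range i \<and> b \<in> range i \<and> inv i a \<le> inv i b}"
  have "inj_on (inv i) (range i)" by (simp add: inj_on_inv_into)
  note R = Well_order_inj_wellorder[OF this R_def]
  define k where "k = pos R \<circ> i"
  have below: "k x < abs_wo R" for x using pos_image[OF R(1)] R(2) by (auto simp: k_def)
  have mono: "k x < k y" if "x < y" for x y
  proof -
    have "(i x, i y) \<in> R" "i x \<noteq> i y" using that i by (auto simp: R_def dest: injD)
    then show ?thesis using pos_mono[OF R(1)] by (simp add: k_def)
  qed
  have "x \<le> k x" for x
  proof (induction x rule: less_induct)
    case (less x)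
    then show ?case using mono by (meson leD leI)
  qed
  with below[of "abs_wo R"] show False by (simp add: leD)
qed

section \<open>Limit and finite parts\<close>

definition succ_of :: "'o::wellorder \<Rightarrow> 'o \<Rightarrow> bool" where
  "succ_of y x \<longleftrightarrow> y < x \<and> (\<forall>z<x. z \<le> y)"

lemma succ_of_unique: "succ_of y x \<Longrightarrow> succ_of y' x \<Longrightarrow> y = y'"
  by (simp add: succ_of_def order.antisym)

lemma succ_of_inj: "succ_of y x \<Longrightarrow> succ_of y x' \<Longrightarrow> x = x'"
  unfolding succ_of_def by (meson leD linorder_neqE)

lemma succ_of_exists:
  fixes y :: "'o::wellorder"
  assumes "y < z"
  obtains x where "succ_of y x" "x \<le> z"
proof -
  define x where "x = (LEAST x. y < x)"
  have "y < x" unfolding x_def using assms by (rule LeastI)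
  moreover have "x \<le> z" unfolding x_def using assms by (rule Least_le)
  moreover have "\<forall>u<x. u \<le> y" unfolding x_def using not_less_Least not_less by blast
  ultimately show thesis using that by (simp add: succ_of_def)
qed

lemma succ_of_The: "succ_of y x \<Longrightarrow> (THE y. succ_of y x) = y"
  using succ_of_unique by blast

text \<open>With \<open>finite_part\<close>, the decomposition x = l + n obtained by stripping
  predecessors. Zero counts as a limit, and \<open>limit_part x = x\<close> serves as the test for
  limits.\<close>

function limit_part :: "'o::wellorder \<Rightarrow> 'o" where
  "limit_part x = (if \<exists>y. succ_of y x then limit_part (THE y. succ_of y x) else x)"
  by auto
termination
  by (relation "{(x, y). x < y}") (auto simp: succ_of_The wf, simp add: succ_of_def)

function finite_part :: "'o::wellorder \<Rightarrow> nat" where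
  "finite_part x = (if \<exists>y. succ_of y x then Suc (finite_part (THE y. succ_of y x)) else 0)"
  by auto
termination
  by (relation "{(x, y). x < y}") (auto simp: succ_of_The wf, simp add: succ_of_def)

declare limit_part.simps [simp del] finite_part.simps [simp del]

lemma parts_succ:
  assumes "succ_of y x"
  shows "limit_part x = limit_part y" and "finite_part x = Suc (finite_part y)"
proof -
  have "(THE y. succ_of y x) = y" using assms succ_of_unique by blast
  then show "limit_part x = limit_part y" and "finite_part x = Suc (finite_part y)"
    using assms limit_part.simps[of x] finite_part.simps[of x] by auto
qed

lemma parts_limit:
  assumes "\<nexists>y. succ_of y x"
  shows "limit_part x = x" and "finite_part x = 0"
  using assms by (simp_all add: limit_part.simps[of x] finite_part.simps[of x])

lemma limit_part_not_succ: "\<not> succ_of y (limit_part x)"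
proof (induction x rule: less_induct)
  case (less x)
  then show ?case by (metis parts_limit(1) parts_succ(1) succ_of_def)
qed

lemma limit_part_idem [simp]: "limit_part (limit_part x) = limit_part x"
  by (rule parts_limit) (use limit_part_not_succ in blast)

lemma limit_part_le: "limit_part x \<le> x"
proof (induction x rule: less_induct)
  case (less x)
  show ?case
  proof (cases "\<exists>y. succ_of y x")
    case True
    then obtain y where y: "succ_of y x" by blast
    then have "y < x" by (simp add: succ_of_def)
    then show ?thesis using less[of y] parts_succ(1)[OF y] by simp
  next
    case False then show ?thesis by (simp add: parts_limit)
  qed
qed

lemma parts_inj:
  assumes "limit_part x = limit_part y" "finite_part x = finite_part y"
  shows "x = y"
  using assms
proof (induction x arbitrary: y rule: less_induct)
  case (less x)
  show ?case
  proof (cases "\<exists>x'. succ_of x' x")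
    case True
    then obtain x' where x': "succ_of x' x" by blast
    then obtain y' where y': "succ_of y' y"
      using less.prems(2) parts_succ(2)[OF x'] parts_limit(2)[of y] by force
    have "x' = y'" using less.IH[of x' y'] less.prems parts_succ[OF x'] parts_succ[OF y'] x'
      by (simp add: succ_of_def)
    then show ?thesis using x' y' succ_of_inj by blast
  next
    case False
    then have "\<nexists>y'. succ_of y' y" using less.prems(2) parts_succ(2)[of _ y] parts_limit(2)[of x] by auto
    with False show ?thesis using less.prems(1) by (simp add: parts_limit)
  qed
qed

text \<open>The ordinals l + i never reach the limit above \<open>l\<close>: a successor of
  something below it is at most the limit and cannot equal it.\<close>

lemma parts_surj_below_limit:
  assumes "l < limit_part z" and "limit_part l = l"
  shows "\<exists>x<limit_part z. limit_part x = l \<and> finite_part x = i"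
proof (induction i)
  case 0
  have "\<nexists>y. succ_of y l" using limit_part_not_succ[of _ l] assms(2) by simp
  then show ?case using assms parts_limit by blast
next
  case (Suc i)
  then obtain x where x: "x < limit_part z" "limit_part x = l" "finite_part x = i" by blast
  obtain u where u: "succ_of x u" "u \<le> limit_part z" using succ_of_exists[OF x(1)] by blast
  then have "u < limit_part z" using limit_part_not_succ[of x z] by (metis order.not_eq_order_implies_strict)
  then show ?case using parts_succ[OF u(1)] x by blast
qed

lemma parts_surj_below:
  assumes "i < finite_part z"
  shows "\<exists>x<z. limit_part x = limit_part z \<and> finite_part x = i"
  using assms
proof (induction z rule: less_induct)
  case (less z)
  then obtain y where y: "succ_of y z" using parts_limit(2)[of z] by force
  then have "y < z" by (simp add: succ_of_def)
  show ?case
  proof (cases "i = finite_part y")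
    case True then show ?thesis using \<open>y < z\<close> parts_succ[OF y] by auto
  next
    case False
    then have "i < finite_part y" using less.prems parts_succ[OF y] by simp
    then show ?thesis using less.IH[OF \<open>y < z\<close>] \<open>y < z\<close> parts_succ[OF y] by (metis order.strict_trans)
  qed
qed

text \<open>The order is lexicographic in limit and finite part: the surjectivity lemmas give an
  ordinal below \<open>y\<close> with the parts of \<open>x\<close>, and \<open>parts_inj\<close>
  identifies it with \<open>x\<close>.\<close>

lemma parts_less:
  assumes "limit_part x < limit_part y \<or> limit_part x = limit_part y \<and> finite_part x < finite_part y"
  shows "x < y"
  using assms
proof
  assume "limit_part x < limit_part y"
  then obtain x' where "x' < limit_part y" "limit_part x' = limit_part x" "finite_part x' = finite_part x"
    using parts_surj_below_limit[of "limit_part x" y "finite_part x"] by auto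
  then show ?thesis using parts_inj[of x' x] limit_part_le[of y] by auto
next
  assume "limit_part x = limit_part y \<and> finite_part x < finite_part y"
  then show ?thesis using parts_surj_below[of "finite_part x" y] parts_inj[of _ x] by auto
qed

lemma limit_part_less:
  assumes "x < z" "\<nexists>y. succ_of y z"
  shows "limit_part x < z"
  using assms limit_part_le[of x] by simp

section \<open>Powers of two as multisets of limit ordinals\<close>

text \<open>For \<open>l\<close> zero or a limit, 2^l is a power of omega, so multisets of such
  \<open>l\<close> are Cantor normal forms: union is the natural sum and the multiset order is the
  order of ordinals. Here 2^(l + n) is 2^n copies of 2^l.\<close>

definition pow2 :: "'o::wellorder \<Rightarrow> 'o multiset" where
  "pow2 x = replicate_mset (2 ^ finite_part x) (limit_part x)"

lemma pow2_succ: "succ_of y x \<Longrightarrow> pow2 x = pow2 y + pow2 y"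
  by (simp add: pow2_def parts_succ mult_2 flip: repeat_mset_distrib)
     (simp add: multiset_eq_iff)

lemma pow2_limit: "\<nexists>y. succ_of y x \<Longrightarrow> pow2 x = {#x#}"
  by (simp add: pow2_def parts_limit)

lemma set_mset_pow2: "set_mset (pow2 x) = {limit_part x}"
  by (simp add: pow2_def)

text \<open>Halving: either the halves already differ, or they agree and only the lowest bit
  decides. This turns a comparison of multiplicities into the comparison rule of
  \<open>oexp2\<close>.\<close>

lemma nat_less_top_bit:
  fixes m n :: nat
  assumes "m < n"
  shows "\<exists>i. \<not> bit m i \<and> bit n i \<and> (\<forall>j>i. bit m j = bit n j)"
  using assms
proof (induction n arbitrary: m rule: less_induct)
  case (less n)
  show ?case
  proof (cases "m div 2 < n div 2")
    case True
    then obtain i where i: "\<not> bit (m div 2) i" "bit (n div 2) i" "\<forall>j>i. bit (m div 2) j = bit (n div 2) j"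
      using less.IH[of "n div 2" "m div 2"] less.prems by auto
    have "bit m j = bit n j" if "j > Suc i" for j
      using that i(3) by (cases j) (auto simp: bit_Suc)
    then show ?thesis using i by (intro exI[of _ "Suc i"]) (auto simp: bit_Suc)
  next
    case False
    then have eq: "m div 2 = n div 2" using less.prems by (meson div_le_mono less_or_eq_imp_le order.antisym not_less)
    then have "even m" "odd n" using less.prems by presburger+
    moreover have "bit m j = bit n j" if "j > 0" for j
      using that eq by (cases j) (auto simp: bit_Suc)
    ultimately show ?thesis by (intro exI[of _ 0]) (auto simp: bit_0)
  qed
qed

lemma bit_nat_imp_ge: "bit (m::nat) i \<Longrightarrow> 2 ^ i \<le> m"
  by (metis bit_iff_odd div_less even_zero not_le)

text \<open>Over a linear order the largest point of difference decides: an excess of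
  \<open>M\<close> there would have to be compensated by an excess of \<open>N\<close> at a still
  larger point.\<close>

lemma multiset_less_top:
  fixes M N :: "'o::linorder multiset"
  assumes "M < N"
  obtains l where "count M l < count N l" "\<And>k. l < k \<Longrightarrow> count M k = count N k"
proof -
  define D where "D = {y. count M y \<noteq> count N y}"
  have "D \<subseteq> set_mset (M + N)" unfolding D_def by (auto simp: count_eq_zero_iff[symmetric] simp del: count_eq_zero_iff)
  then have "finite D" by (rule finite_subset) simp
  moreover have "D \<noteq> {}" using assms unfolding D_def by (metis (mono_tags, lifting) empty_Collect_eq less_irrefl multiset_eqI)
  ultimately have l: "Max D \<in> D" "\<And>k. k \<in> D \<Longrightarrow> k \<le> Max D" by auto
  then have eq: "count M k = count N k" if "Max D < k" for k using that by (force simp: D_def)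
  moreover have "count M (Max D) < count N (Max D)"
  proof (rule ccontr)
    assume "\<not> ?thesis"
    then have "count N (Max D) < count M (Max D)" using l(1) by (simp add: D_def)
    then obtain x where "Max D < x" "count M x < count N x"
      using assms by (auto simp: less_multiset\<^sub>H\<^sub>O)
    then show False using eq by simp
  qed
  ultimately show thesis using that by blast
qed

text \<open>In terms of normal forms: an ordinal below 2^(l + n) has exponents at most
  \<open>l\<close>, and the coefficient of 2^l is below 2^n.\<close>

lemma less_pow2_count:
  fixes x :: "'o::wellorder"
  assumes "M < pow2 x" "l \<in># M"
  shows "l < limit_part x \<or> l = limit_part x \<and> count M l < 2 ^ finite_part x"
proof -
  have *: "\<exists>k>y. count M k < count (pow2 x) k" if "count (pow2 x) y < count M y" for y
    using assms(1) that by (auto simp: less_multiset\<^sub>H\<^sub>O)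
  have count: "count (pow2 x) k = (if k = limit_part x then 2 ^ finite_part x else 0)" for k
    by (simp add: pow2_def)
  show ?thesis
  proof (cases "l = limit_part x")
    case True
    have "\<not> pow2 x \<subseteq># M" using assms(1) by (meson subset_eq_imp_le_multiset leD)
    then have "count M l < 2 ^ finite_part x"
      using True by (auto simp: subseteq_mset_def count split: if_splits)
    with True show ?thesis by simp
  next
    case False
    then have "count (pow2 x) l < count M l" using assms(2) by (simp add: count)
    then obtain k where "l < k" "count M k < count (pow2 x) k" using * by blast
    then show ?thesis by (simp add: count split: if_splits)
  qed
qed

text \<open>Binary digit \<open>i\<close> of the coefficient of 2^l stands for the summand 2^(l +
  i). The lemma shows that its exponent l + i exists and lies below \<open>x\<close>.\<close>

lemma exists_parts_below:
  fixes x :: "'o::wellorder"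
  assumes "M < pow2 x" "limit_part l = l" "bit (count M l) i"
  shows "\<exists>y<x. limit_part y = l \<and> finite_part y = i"
proof -
  have ge: "2 ^ i \<le> count M l" using assms(3) by (rule bit_nat_imp_ge)
  then have "l \<in># M" by (metis count_eq_zero_iff le_zero_eq power_not_zero zero_neq_numeral)
  then consider "l < limit_part x" | "l = limit_part x" "count M l < 2 ^ finite_part x"
    using less_pow2_count[OF assms(1)] by blast
  then show ?thesis
  proof cases
    case 1
    then show ?thesis using parts_surj_below_limit[OF 1 assms(2)] limit_part_le[of x] by (meson order.strict_trans2)
  next
    case 2
    have "i < finite_part x"
      using power_less_imp_less_exp[OF _ le_less_trans[OF ge 2(2)]] by simp
    then show ?thesis using parts_surj_below 2(1) by auto
  qed
qed

section \<open>Order types of residuals\<close>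

definition residual :: "'a set \<Rightarrow> ('a \<Rightarrow> 'a \<Rightarrow> bool) \<Rightarrow> 'a list \<Rightarrow> 'a set" where
  "residual A le s = {x \<in> A. \<forall>y\<in>set s. \<not> le y x}"

lemma residual_Nil [simp]: "residual A le [] = A"
  by (simp add: residual_def)

lemma residual_snoc: "residual A le (s @ [x]) = {y \<in> residual A le s. \<not> le x y}"
  by (auto simp: residual_def)

lemma Nil_in_Bad [simp]: "[] \<in> Bad A le"
  by (simp add: Bad_def bad_seq_def)

lemma snoc_in_Bad_iff: "s @ [x] \<in> Bad A le \<longleftrightarrow> s \<in> Bad A le \<and> x \<in> residual A le s"
proof -
  have bad: "bad_seq le t \<longleftrightarrow> sorted_wrt (\<lambda>y x. \<not> le y x) t" for t
    unfolding bad_seq_def sorted_wrt_iff_nth_less by blast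
  show ?thesis by (auto simp: Bad_def residual_def bad sorted_wrt_append)
qed

text \<open>A multiset of limit ordinals stands for the natural sum of the ordinals \<open>2 ^ x\<close> over its
  elements \<open>x\<close>; the predicate says that \<open>C\<close> has maximal order type at most this sum.\<close>

inductive otype_le :: "('c \<Rightarrow> 'c \<Rightarrow> bool) \<Rightarrow> 'c set \<Rightarrow> 'o::wellorder multiset \<Rightarrow> bool" for le where
  otype_leI: "\<lbrakk>\<forall>x\<in>#M. limit_part x = x;
     \<forall>S\<in>C. \<exists>M'<M. otype_le le {T \<in> C. \<not> le S T} M'\<rbrakk> \<Longrightarrow> otype_le le C M"

lemma otype_le_step:
  "otype_le le C M \<Longrightarrow> S \<in> C \<Longrightarrow> \<exists>M'<M. otype_le le {T \<in> C. \<not> le S T} M'"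
  by (erule otype_le.cases) blast

text \<open>A map that reflects the order sends bad sequences to bad sequences, so the bound for the
  target also holds for the source.\<close>

lemma otype_le_reflect:
  assumes "otype_le le' D M" "f ` C \<subseteq> D"
    and "\<And>S T. S \<in> C \<Longrightarrow> T \<in> C \<Longrightarrow> le' (f S) (f T) \<Longrightarrow> le S T"
  shows "otype_le le C M"
  using assms
proof (induction arbitrary: C)
  case (otype_leI M D)
  show ?case
  proof (rule otype_le.otype_leI[OF otype_leI(1)], rule ballI)
    fix S assume S: "S \<in> C"
    let ?C = "{T \<in> C. \<not> le S T}"
    have "f S \<in> D" using S otype_leI.prems(1) by blast
    moreover have "f ` ?C \<subseteq> {T \<in> D. \<not> le' (f S) T}" using S otype_leI.prems by blast
    moreover have "\<And>S T. S \<in> ?C \<Longrightarrow> T \<in> ?C \<Longrightarrow> le' (f S) (f T) \<Longrightarrow> le S T" using otype_leI.prems by blast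
    ultimately show "\<exists>M'<M. otype_le le ?C M'" using otype_leI.IH by meson
  qed
qed

lemma otype_le_subset: "otype_le le D M \<Longrightarrow> C \<subseteq> D \<Longrightarrow> otype_le le C M"
  by (rule otype_le_reflect[of le D M "\<lambda>x. x"]) auto

lemma otype_le_empty: "otype_le le {} {#}"
  by (rule otype_leI) auto

text \<open>A choice of \<open>S\<close> in one part lowers the bound of that part, while the
  residual of the other part keeps its old bound. Since either part may shrink, the induction is
  nested, and the sum of multisets is strictly monotone in both arguments.\<close>

lemma otype_le_Un:
  assumes "otype_le le C M" "otype_le le D N"
  shows "otype_le le (C \<union> D) (M + N)"
  using assms
proof (induction arbitrary: D N)
  case (otype_leI M C)
  note C = otype_leI
  note outer_IH = otype_leI.IH
  from otype_leI.prems show ?case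
  proof induction
    case (otype_leI N D)
    show ?case
    proof (rule otype_le.otype_leI)
      show "\<forall>x\<in>#M + N. limit_part x = x" using C(1) otype_leI(1) by auto
      show "\<forall>S\<in>C \<union> D. \<exists>M'<M + N. otype_le le {T \<in> C \<union> D. \<not> le S T} M'"
      proof
        fix S assume "S \<in> C \<union> D"
        then consider "S \<in> C" | "S \<in> D" by blast
        then show "\<exists>M'<M + N. otype_le le {T \<in> C \<union> D. \<not> le S T} M'"
        proof cases
          case 1
          then obtain M' where M': "M' < M"
            "\<And>E K. otype_le le E K \<Longrightarrow> otype_le le ({T \<in> C. \<not> le S T} \<union> E) (M' + K)"
            using bspec[OF outer_IH 1] by blast
          \<comment> \<open>The inner induction has split this premise into its components; it is
            reassembled so that the outer hypothesis can be applied with \<open>D\<close>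
            itself.\<close>
          have "otype_le le D N"
            using otype_leI by (intro otype_le.otype_leI) auto
          then have "otype_le le ({T \<in> C. \<not> le S T} \<union> D) (M' + N)" by (rule M'(2))
          then have "otype_le le {T \<in> C \<union> D. \<not> le S T} (M' + N)" by (rule otype_le_subset) auto
          then show ?thesis using M'(1) by (intro exI[of _ "M' + N"]) simp
        next
          case 2
          then obtain N' where N': "N' < N" "otype_le le (C \<union> {T \<in> D. \<not> le S T}) (M + N')"
            using otype_leI.IH by blast
          from N'(2) have "otype_le le {T \<in> C \<union> D. \<not> le S T} (M + N')" by (rule otype_le_subset) auto
          then show ?thesis using N'(1) by (intro exI[of _ "M + N'"]) simp
        qed
      qed
    qed
  qed
qed

lemma otype_le_UN:
  assumes "finite X" "\<And>a. a \<in> X \<Longrightarrow> otype_le le (C a) (g a)"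
  shows "otype_le le (\<Union>a\<in>X. C a) (\<Sum>a\<in>X. g a)"
  using assms
proof (induction X rule: finite_induct)
  case empty then show ?case by (simp add: otype_le_empty)
next
  case (insert a X)
  then have "otype_le le (C a \<union> (\<Union>a\<in>X. C a)) (g a + (\<Sum>a\<in>X. g a))" by (intro otype_le_Un) auto
  then show ?case using insert.hyps by simp
qed

text \<open>A single \<open>a\<close> in \<open>S\<close> without an upper bound in \<open>T\<close>
  witnesses the failure of the Hoare embedding, and then all of \<open>T\<close> lies in the
  residual of \<open>a\<close>.\<close>

lemma Pf_residual:
  "{T \<in> Pf B. \<not> hoare le S T} = (\<Union>a\<in>S. Pf {x \<in> B. \<not> le a x})"
proof (rule set_eqI)
  show "T \<in> {T \<in> Pf B. \<not> hoare le S T} \<longleftrightarrow> T \<in> (\<Union>a\<in>S. Pf {x \<in> B. \<not> le a x})" for T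
    unfolding Pf_def hoare_def mem_Collect_eq UN_iff subset_iff by metis
qed

section \<open>The upper bound by induction over residuals\<close>

text \<open>The supremum in the definition of rank is split into being a strict bound and being the
  least one, for values in an arbitrary well-ordered type.\<close>

locale bad_rank =
  fixes A :: "'a set" and le :: "'a \<Rightarrow> 'a \<Rightarrow> bool" and R :: "'a list \<Rightarrow> 'o::wellorder"
  assumes qo: "qo_on A le"
    and rank_less: "s @ [x] \<in> Bad A le \<Longrightarrow> R (s @ [x]) < R s"
    and rank_least: "s \<in> Bad A le \<Longrightarrow> (\<And>x. s @ [x] \<in> Bad A le \<Longrightarrow> R (s @ [x]) < u) \<Longrightarrow> R s \<le> u"
begin

lemma le_trans: "x \<in> A \<Longrightarrow> y \<in> A \<Longrightarrow> z \<in> A \<Longrightarrow> le x y \<Longrightarrow> le y z \<Longrightarrow> le x z"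
  using qo unfolding qo_on_def by blast

text \<open>The residual determines which extensions are possible, so every child of
  \<open>s\<close> is matched by a child of \<open>t\<close> with the same last element, again with
  included residuals.\<close>

lemma rank_mono_residual:
  assumes "s \<in> Bad A le" "t \<in> Bad A le" "residual A le s \<subseteq> residual A le t"
  shows "R s \<le> R t"
  using assms
proof (induction "R s" arbitrary: s t rule: less_induct)
  case less
  show ?case
  proof (rule rank_least[OF less.prems(1)])
    fix x assume x: "s @ [x] \<in> Bad A le"
    then have t: "t @ [x] \<in> Bad A le" using less.prems by (auto simp: snoc_in_Bad_iff)
    have "R (s @ [x]) \<le> R (t @ [x])"
      by (rule less.hyps[OF rank_less[OF x] x t]) (use less.prems(3) in \<open>auto simp: residual_snoc\<close>)
    then show "R (s @ [x]) < R t" using rank_less[OF t] by simp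
  qed
qed

text \<open>If \<open>b\<close> were strictly above \<open>a\<close>, choosing \<open>b\<close>
  before \<open>a\<close> would leave the same elements as choosing \<open>a\<close> alone. Then
  \<open>R (s @ [b])\<close> would lie strictly between the successor \<open>R s\<close> and its
  predecessor \<open>R (s @ [a])\<close>.\<close>

lemma rank_succ_maximal:
  assumes "succ_of (R (s @ [a])) (R s)" and sa: "s @ [a] \<in> Bad A le"
    and b: "b \<in> residual A le s" "le a b"
  shows "le b a"
proof (rule ccontr)
  assume "\<not> le b a"
  have a: "a \<in> residual A le s" and s: "s \<in> Bad A le" using sa by (auto simp: snoc_in_Bad_iff)
  then have sb: "s @ [b] \<in> Bad A le" using b by (simp add: snoc_in_Bad_iff)
  then have sba: "(s @ [b]) @ [a] \<in> Bad A le"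
    unfolding snoc_in_Bad_iff[of "s @ [b]" a] using a sb \<open>\<not> le b a\<close> by (simp add: residual_snoc)
  have "residual A le (s @ [a]) \<subseteq> residual A le ((s @ [b]) @ [a])"
  proof
    fix y assume y: "y \<in> residual A le (s @ [a])"
    have "a \<in> A" "b \<in> A" "y \<in> A" using a b y by (auto simp: residual_def)
    then have "\<not> le b y" using y b(2) le_trans[of a b y] by (auto simp: residual_snoc)
    then show "y \<in> residual A le ((s @ [b]) @ [a])" using y by (simp add: residual_def)
  qed
  then have "R (s @ [a]) \<le> R ((s @ [b]) @ [a])" by (rule rank_mono_residual[OF sa sba])
  also have "\<dots> < R (s @ [b])" by (rule rank_less[OF sba])
  also have "R (s @ [b]) \<le> R (s @ [a])"
    using assms(1) rank_less[OF sb] by (simp add: succ_of_def)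
  finally show False by simp
qed

text \<open>Stated for all residuals so that induction on \<open>R s\<close> applies; the bound for
  \<open>Pf A\<close> is the case \<open>s = []\<close>.\<close>

lemma otype_le_Pf_residual:
  assumes "s \<in> Bad A le"
  shows "otype_le (hoare le) (Pf (residual A le s)) (pow2 (R s))"
  using assms
proof (induction "R s" arbitrary: s rule: less_induct)
  case less
  define B where "B = residual A le s"
  have BA: "B \<subseteq> A" by (auto simp: B_def residual_def)
  have child: "s @ [a] \<in> Bad A le" if "a \<in> B" for a
    using that less.prems by (simp add: snoc_in_Bad_iff B_def)
  have res: "residual A le (s @ [a]) = {x \<in> B. \<not> le a x}" for a
    by (simp add: residual_snoc B_def)
  have IH: "otype_le (hoare le) (Pf {x \<in> B. \<not> le a x}) (pow2 (R (s @ [a])))" if "a \<in> B" for a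
    using less.hyps[OF rank_less] child[OF that] res by metis
  have "otype_le (hoare le) (Pf B) (pow2 (R s))"
  proof (cases "\<exists>y. succ_of y (R s)")
    case True
    then obtain y where y: "succ_of y (R s)" by blast
    \<comment> \<open>If every child had rank below \<open>y\<close>, then \<open>R s\<close> would
      be at most \<open>y\<close>. So some child attains rank exactly \<open>y\<close>.\<close>
    have "\<exists>a. s @ [a] \<in> Bad A le \<and> y \<le> R (s @ [a])"
    proof (rule ccontr)
      assume "\<not> ?thesis"
      then have "R s \<le> y" by (intro rank_least[OF less.prems]) (auto simp: not_le)
      with y show False by (auto simp: succ_of_def dest: leD)
    qed
    then obtain a where a: "s @ [a] \<in> Bad A le" "R (s @ [a]) = y"
      using y rank_less by (metis order.antisym succ_of_def)
    then have aB: "a \<in> B" by (simp add: snoc_in_Bad_iff B_def)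
    have top: "le b a" if "b \<in> B" "le a b" for b
      using rank_succ_maximal[of s a b] y a that by (simp add: B_def)
    define C where "C = Pf {x \<in> B. \<not> le a x}"
    define D where "D = {S \<in> Pf B. \<exists>b\<in>S. le a b}"
    have C: "otype_le (hoare le) C (pow2 y)" using IH[OF aB] a by (simp add: C_def)
    \<comment> \<open>By \<open>top\<close>, elements of \<open>B\<close> above \<open>a\<close> are
      equivalent to \<open>a\<close>. Every member of \<open>D\<close> contains one, so deleting
      them loses no information up to equivalence: the deletion maps \<open>D\<close> to
      \<open>C\<close> and reflects the Hoare order.\<close>
    have D: "otype_le (hoare le) D (pow2 y)"
    proof (rule otype_le_reflect[OF C, of "\<lambda>S. {x \<in> S. \<not> le a x}"])
      show "(\<lambda>S. {x \<in> S. \<not> le a x}) ` D \<subseteq> C" by (auto simp: C_def D_def Pf_def)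
      fix S T assume ST: "S \<in> D" "T \<in> D" and le: "hoare le {x \<in> S. \<not> le a x} {x \<in> T. \<not> le a x}"
      from ST obtain b where b: "b \<in> T" "le a b" by (auto simp: D_def)
      show "hoare le S T"
        unfolding hoare_def
      proof
        fix x assume x: "x \<in> S"
        show "\<exists>b\<in>T. le x b"
        proof (cases "le a x")
          case True
          have "x \<in> B" "b \<in> B" using ST x b by (auto simp: D_def Pf_def)
          then have "le x b" using top[OF _ True] b le_trans[of x a b] aB BA by blast
          with b show ?thesis by blast
        next
          case False then show ?thesis using le x by (auto simp: hoare_def)
        qed
      qed
    qed
    have "Pf B \<subseteq> C \<union> D" by (auto simp: C_def D_def Pf_def)
    with otype_le_Un[OF C D] show ?thesis unfolding pow2_succ[OF y] by (rule otype_le_subset)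
  next
    case False
    show ?thesis
    proof (rule otype_leI)
      show "\<forall>x\<in>#pow2 (R s). limit_part x = x" by (simp add: set_mset_pow2)
      show "\<forall>S\<in>Pf B. \<exists>M'<pow2 (R s). otype_le (hoare le) {T \<in> Pf B. \<not> hoare le S T} M'"
      proof
        fix S assume S: "S \<in> Pf B"
        then have "finite S" "S \<subseteq> B" by (auto simp: Pf_def)
        let ?M = "\<Sum>a\<in>S. pow2 (R (s @ [a]))"
        have "otype_le (hoare le) {T \<in> Pf B. \<not> hoare le S T} ?M"
          unfolding Pf_residual using \<open>finite S\<close> \<open>S \<subseteq> B\<close> IH by (intro otype_le_UN) auto
        \<comment> \<open>One copy of \<open>R s\<close> exceeds any finite multiset of smaller
          elements. This includes rank zero: there \<open>B\<close> is empty, only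
          \<open>S = {}\<close> remains, and the sum is \<open>{#}\<close>.\<close>
        moreover have "?M < pow2 (R s)"
          unfolding pow2_limit[OF False] mset_lt_single_right_iff
          using \<open>finite S\<close> \<open>S \<subseteq> B\<close> limit_part_less[OF rank_less[OF child] False]
          by (auto simp: set_mset_sum set_mset_pow2)
        ultimately show "\<exists>M'<pow2 (R s). otype_le (hoare le) {T \<in> Pf B. \<not> hoare le S T} M'" by blast
      qed
    qed
  qed
  then show ?case by (simp add: B_def)
qed

end

section \<open>Rank functions\<close>

lemma is_rank_fun_exists:
  fixes N :: "'n set"
  assumes inf: "infinite (UNIV :: 'n set)" and wf: "wf {(t, s). s \<in> N \<and> t \<in> N \<and> ch s t}"
  shows "\<exists>\<rho>. is_rank_fun N ch \<rho>"
proof -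
  define r where "r = {(t, s). s \<in> N \<and> t \<in> N \<and> ch s t}"
  define R :: "'n \<Rightarrow> 'n wo" where "R = wfrec r (\<lambda>f s. LEAST x. \<forall>t. (t, s) \<in> r \<longrightarrow> f t < x)"
  have R: "R s = (LEAST x. \<forall>t. (t, s) \<in> r \<longrightarrow> R t < x)" for s
  proof -
    have "R s = (LEAST x. \<forall>t. (t, s) \<in> r \<longrightarrow> cut R r s t < x)"
      unfolding R_def by (subst wfrec) (use wf in \<open>simp_all add: r_def\<close>)
    then show ?thesis by (simp add: cut_apply cong: imp_cong)
  qed
  \<comment> \<open>One bound for all values of \<open>R\<close> at once ensures that each
    \<open>LEAST\<close> in the recursion ranges over a nonempty set.\<close>
  obtain u where u: "\<And>t. R t < u" using wo_bounded[OF inf, of R] by blast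
  have less: "R t < R s" if "(t, s) \<in> r" for s t
    using LeastI[of "\<lambda>x. \<forall>t. (t, s) \<in> r \<longrightarrow> R t < x" u] u that unfolding R[of s, symmetric] by blast
  have least: "R s \<le> x" if "\<And>t. (t, s) \<in> r \<Longrightarrow> R t < x" for s x
    unfolding R[of s] by (rule Least_le) (use that in blast)
  have rep: "Well_order (rep_wo x)" "abs_wo (rep_wo x) = x" for x :: "'n wo"
    using Quotient3_wo unfolding Quotient3_def by (metis ordIso_refl_iff)+
  have "is_rank_fun N ch (rep_wo \<circ> R)"
    unfolding is_rank_fun_def
  proof (intro ballI conjI impI allI)
    fix s assume s: "s \<in> N"
    show "Well_order ((rep_wo \<circ> R) s)" by (simp add: rep)
    show "(rep_wo \<circ> R) t <o (rep_wo \<circ> R) s" if "t \<in> N" "ch s t" for t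
      using less[of t s] s that by (simp add: r_def rep flip: abs_wo_less_iff)
    fix w :: "'n rel" assume w: "Well_order w \<and> (\<forall>t\<in>N. ch s t \<longrightarrow> (rep_wo \<circ> R) t <o w)"
    have "R s \<le> abs_wo w"
    proof (rule least)
      fix t assume "(t, s) \<in> r"
      with w have "rep_wo (R t) <o w" by (simp add: r_def)
      then show "R t < abs_wo w" using w abs_wo_less_iff[OF rep(1)[of "R t"], of w] by (simp add: rep)
    qed
    then show "(rep_wo \<circ> R) s \<le>o w" using w abs_wo_le_iff[OF rep(1)[of "R s"], of w] by (simp add: rep)
  qed
  then show ?thesis by blast
qed

lemma is_rank_funD:
  assumes "is_rank_fun N ch \<rho>" "s \<in> N"
  shows "Well_order (\<rho> s)" and "t \<in> N \<Longrightarrow> ch s t \<Longrightarrow> \<rho> t <o \<rho> s"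
  using assms unfolding is_rank_fun_def by blast+

text \<open>The definition of a rank function compares only with well-orders on the node type; here
  \<open>w\<close> may live on any type. A \<open>w\<close> shorter than \<open>\<rho> s\<close> is
  isomorphic to an initial segment of \<open>\<rho> s\<close>, which does live on the node
  type.\<close>

lemma is_rank_fun_least:
  fixes w :: "'m rel"
  assumes \<rho>: "is_rank_fun N ch \<rho>" and s: "s \<in> N" and w: "Well_order w"
    and bound: "\<And>t. t \<in> N \<Longrightarrow> ch s t \<Longrightarrow> \<rho> t <o w"
  shows "\<rho> s \<le>o w"
proof (rule ccontr)
  note W = is_rank_funD(1)[OF \<rho> s]
  assume "\<not> \<rho> s \<le>o w"
  then have "w <o \<rho> s" using ordLess_or_ordLeq[OF w W] by blast
  then obtain a where a: "a \<in> Field (\<rho> s)" "w =o Restr (\<rho> s) (underS (\<rho> s) a)"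
    using ordLess_iff_ordIso_Restr[OF W w] by blast
  let ?v = "Restr (\<rho> s) (underS (\<rho> s) a)"
  have "\<forall>t\<in>N. ch s t \<longrightarrow> \<rho> t <o ?v" using bound a(2) ordLess_ordIso_trans by blast
  moreover have "Well_order ?v" by (rule Well_order_Restr[OF W])
  ultimately have "\<rho> s \<le>o ?v" using \<rho> s unfolding is_rank_fun_def by blast
  moreover have "?v <o \<rho> s" using a(1) by (intro underS_Restr_ordLess[OF W]) auto
  ultimately show False using not_ordLess_ordLeq by blast
qed

lemma wf_Bad:
  assumes "\<And>f :: nat \<Rightarrow> 'a. \<forall>i. f i \<in> A \<Longrightarrow> \<exists>i j. i < j \<and> le (f i) (f j)"
  shows "wf {(t, s). s \<in> Bad A le \<and> t \<in> Bad A le \<and> child s t}"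
  unfolding wf_iff_no_infinite_down_chain
proof
  assume "\<exists>f. \<forall>i. (f (Suc i), f i) \<in> {(t, s). s \<in> Bad A le \<and> t \<in> Bad A le \<and> child s t}"
  then obtain f where f: "\<And>i. f i \<in> Bad A le" "\<And>i. child (f i) (f (Suc i))" by auto
  then obtain g where g: "\<And>i. f (Suc i) = f i @ [g i]" unfolding child_def by metis
  \<comment> \<open>The chain may start at any node, so the fixed prefix \<open>f 0\<close> stays in
    front of the infinite bad sequence \<open>g\<close>.\<close>
  have f_eq: "f i = f 0 @ map g [0..<i]" for i by (induction i) (auto simp: g)
  have res: "g j \<in> residual A le (f j)" for j
    using f(1)[of "Suc j"] unfolding g snoc_in_Bad_iff by blast
  then have "\<not> le (g i) (g j)" if "i < j" for i j
    using that by (force simp: residual_def f_eq[of j])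
  moreover have "g j \<in> A" for j using res[of j] by (simp add: residual_def)
  ultimately show False using assms[of g] by blast
qed

text \<open>After \<open>f 0\<close>, the tail of a bad sequence stays in a residual with a smaller
  bound. This makes the finite powerset free of infinite bad sequences, so that its tree has
  ranks.\<close>

lemma otype_le_no_bad_sequence:
  assumes "otype_le le C M" "\<forall>i :: nat. f i \<in> C"
  shows "\<exists>i j. i < j \<and> le (f i) (f j)"
  using assms
proof (induction arbitrary: f)
  case (otype_leI M C)
  show ?case
  proof (cases "\<exists>j. le (f 0) (f (Suc j))")
    case True then show ?thesis by blast
  next
    case False
    then have "\<forall>i. f (Suc i) \<in> {T \<in> C. \<not> le (f 0) T}" using otype_leI.prems by blast
    moreover have "f 0 \<in> C" using otype_leI.prems by blast
    then obtain M' where "\<forall>g. (\<forall>i :: nat. g i \<in> {T \<in> C. \<not> le (f 0) T}) \<longrightarrow> (\<exists>i j. i < j \<and> le (g i) (g j))"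
      using bspec[OF otype_leI.IH] by blast
    ultimately have "\<exists>i j. i < j \<and> le (f (Suc i)) (f (Suc j))"
      by (elim allE[of _ "\<lambda>i. f (Suc i)"]) blast
    then show ?thesis by (meson Suc_less_eq)
  qed
qed

lemma is_rank_fun_node_rank:
  assumes "\<And>f :: nat \<Rightarrow> 'a. \<forall>i. f i \<in> A \<Longrightarrow> \<exists>i j. i < j \<and> le (f i) (f j)"
  shows "is_rank_fun (Bad A le) child (node_rank (Bad A le) child)"
proof -
  have "\<exists>\<rho>. is_rank_fun (Bad A le) child \<rho>"
    by (rule is_rank_fun_exists[OF infinite_UNIV_listI wf_Bad[OF assms]])
  then have "is_rank_fun (Bad A le) child (SOME \<rho>. is_rank_fun (Bad A le) child \<rho>)" by (rule someI_ex)
  then show ?thesis by (simp add: node_rank_def[abs_def])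
qed

lemma bad_rank_abs_wo:
  assumes \<rho>: "is_rank_fun (Bad A le) child \<rho>" and "qo_on A le"
  shows "bad_rank A le (\<lambda>s. abs_wo (\<rho> s))"
proof
  show "qo_on A le" by fact
  show "abs_wo (\<rho> (s @ [x])) < abs_wo (\<rho> s)" if "s @ [x] \<in> Bad A le" for s x
    using that is_rank_funD[OF \<rho>] by (simp add: snoc_in_Bad_iff[of s x] abs_wo_less_iff child_def)
  fix s u
  assume s: "s \<in> Bad A le" and u: "\<And>x. s @ [x] \<in> Bad A le \<Longrightarrow> abs_wo (\<rho> (s @ [x])) < u"
  obtain w where w: "Well_order w" "u = abs_wo w" by (rule wo_class_exhaust)
  have "\<rho> s \<le>o w"
  proof (rule is_rank_fun_least[OF \<rho> s w(1)])
    fix t assume "t \<in> Bad A le" "child s t"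
    then show "\<rho> t <o w" using u w is_rank_funD(1)[OF \<rho>] by (auto simp: child_def abs_wo_less_iff)
  qed
  then show "abs_wo (\<rho> s) \<le> u" using w is_rank_funD(1)[OF \<rho> s] by (simp add: abs_wo_le_iff)
qed

section \<open>Comparison with the ordinal arithmetic\<close>

text \<open>A finite set becomes a multiset of positions with multiplicities at most 1. On these the
  multiset order decides at the largest difference, as \<open>oexp2\<close> does, so
  \<open>oexp2\<close> inherits its well-ordering from multisets.\<close>

lemma oexp2_eq:
  fixes w :: "'n rel"
  assumes w: "Well_order w"
  shows "inj_on (\<lambda>F. mset_set (pos w ` F)) {F. finite F \<and> F \<subseteq> Field w}" (is "inj_on ?\<phi> ?F")
    and "oexp2 w = {(F, G). F \<in> {F. finite F \<and> F \<subseteq> Field w} \<and> G \<in> {F. finite F \<and> F \<subseteq> Field w} \<and>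
           mset_set (pos w ` F) \<le> mset_set (pos w ` G)}"
proof -
  note inj = pos_inj[OF w]
  show inj_\<phi>: "inj_on ?\<phi> ?F"
  proof (rule inj_onI)
    fix F G assume FG: "F \<in> ?F" "G \<in> ?F" "?\<phi> F = ?\<phi> G"
    then have "pos w ` F = pos w ` G" by (metis (mono_tags, lifting) finite_imageI finite_set_mset_mset_set mem_Collect_eq)
    then show "F = G" using inj_on_image_eq_iff[OF inj, of F G] FG by simp
  qed
  have count: "count (?\<phi> F) (pos w a) = (if a \<in> F then 1 else 0)" if "F \<in> ?F" "a \<in> Field w" for F a
    using that inj_on_image_mem_iff[OF inj, of a F] by (simp add: count_mset_set')
  have outside: "count (?\<phi> F) y = 0" if "F \<in> ?F" "y \<notin> pos w ` Field w" for F y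
    using that by (auto simp: count_mset_set')
  have "?\<phi> F \<le> ?\<phi> G" if FG: "F \<in> ?F" "G \<in> ?F" and b: "b \<in> G - F" "\<forall>a\<in>F - G. (a, b) \<in> w" for F G b
  proof -
    have bw: "b \<in> Field w" using FG b by auto
    have "?\<phi> F < ?\<phi> G"
      unfolding less_multiset\<^sub>H\<^sub>O
    proof (intro conjI allI impI)
      show "?\<phi> F \<noteq> ?\<phi> G" using inj_onD[OF inj_\<phi> _ FG] b by blast
      fix y assume y: "count (?\<phi> G) y < count (?\<phi> F) y"
      then obtain a where a: "a \<in> Field w" "y = pos w a" using outside[OF FG(1)] by fastforce
      then have "a \<in> F - G" using y count FG by (auto split: if_splits)
      then have "y < pos w b" using b a pos_mono[OF w, of a b] by auto
      moreover have "count (?\<phi> F) (pos w b) < count (?\<phi> G) (pos w b)" using count[OF _ bw] FG b by simp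
      ultimately show "\<exists>x>y. count (?\<phi> F) x < count (?\<phi> G) x" by blast
    qed
    then show ?thesis by simp
  qed
  moreover have "\<exists>b\<in>G - F. \<forall>a\<in>F - G. (a, b) \<in> w" if FG: "F \<in> ?F" "G \<in> ?F" "?\<phi> F \<le> ?\<phi> G" "F \<noteq> G" for F G
  proof -
    have "?\<phi> F \<noteq> ?\<phi> G" using inj_onD[OF inj_\<phi> _ FG(1,2)] FG(4) by blast
    then have "?\<phi> F < ?\<phi> G" using FG(3) by simp
    then obtain l where l: "count (?\<phi> F) l < count (?\<phi> G) l" "\<And>k. l < k \<Longrightarrow> count (?\<phi> F) k = count (?\<phi> G) k"
      using multiset_less_top by blast
    then obtain b where b: "b \<in> Field w" "l = pos w b" using outside[OF FG(2)] by fastforce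
    have "(a, b) \<in> w" if "a \<in> F - G" for a
    proof -
      have a: "a \<in> Field w" using that FG by auto
      have "count (?\<phi> F) (pos w a) \<noteq> count (?\<phi> G) (pos w a)" using count[OF _ a] FG that by simp
      then have "\<not> l < pos w a" using l(2) by blast
      then show ?thesis using pos_le_iff[OF w a b(1)] b(2) by (simp add: not_less)
    qed
    moreover have "b \<in> G - F" using l(1) count[OF _ b(1)] FG unfolding b(2) by (auto split: if_splits)
    ultimately show ?thesis by blast
  qed
  ultimately show "oexp2 w = {(F, G). F \<in> ?F \<and> G \<in> ?F \<and> ?\<phi> F \<le> ?\<phi> G}"
    unfolding oexp2_def mem_Collect_eq by (intro set_eqI, unfold split_paired_all mem_Collect_eq prod.case) (metis order.refl)
qed

lemma Well_order_oexp2: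
  assumes "Well_order w"
  shows "Well_order (oexp2 w)" and "Field (oexp2 w) = {F. finite F \<and> F \<subseteq> Field w}"
  by (rule Well_order_inj_wellorder[OF oexp2_eq[OF assms]])+

section \<open>Binary digits and the upper bound\<close>

text \<open>The base-2 normal form of the ordinal denoted by \<open>M\<close>: a point at position l
  + i belongs to the set iff 2^i occurs in the binary expansion of the multiplicity of
  \<open>l\<close>.\<close>

definition bits :: "'n rel \<Rightarrow> 'n wo multiset \<Rightarrow> 'n set" where
  "bits w M = {a \<in> Field w. bit (count M (limit_part (pos w a))) (finite_part (pos w a))}"

text \<open>A set digit \<open>i\<close> of a multiplicity c forces i < 2^i \<le> c, so only
  finitely many pairs of limit and digit can occur.\<close>

lemma finite_bits:
  assumes w: "Well_order w"
  shows "finite (bits w M)"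
proof (rule inj_on_finite)
  let ?f = "\<lambda>a. (limit_part (pos w a), finite_part (pos w a))"
  show "inj_on ?f (bits w M)"
  proof (rule inj_onI)
    fix a b assume "a \<in> bits w M" "b \<in> bits w M" "?f a = ?f b"
    then show "a = b" using parts_inj inj_onD[OF pos_inj[OF w]] by (fastforce simp: bits_def)
  qed
  show "?f ` bits w M \<subseteq> (SIGMA l : set_mset M. {..count M l})"
  proof clarify
    fix a assume a: "a \<in> bits w M"
    then have "2 ^ finite_part (pos w a) \<le> count M (limit_part (pos w a))" (is "2 ^ ?i \<le> ?c")
      by (auto simp: bits_def intro: bit_nat_imp_ge)
    moreover have "?i < 2 ^ ?i" by (rule less_exp)
    ultimately have "?i < ?c" by linarith
    then show "limit_part (pos w a) \<in># M \<and> ?i \<in> {..?c}" by (auto simp: count_greater_zero_iff[symmetric] simp del: count_greater_zero_iff)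
  qed
  show "finite (SIGMA l : set_mset M. {..count M l})" by simp
qed

text \<open>The largest \<open>l\<close> where the multiplicities differ and the top differing bit
  \<open>i\<close> there give the exponent l + i that decides in \<open>oexp2\<close>. The bound on
  \<open>N\<close> places this exponent inside \<open>Field w\<close>.\<close>

lemma bits_strict_mono:
  assumes w: "Well_order w" and MN: "M < N" "N < pow2 (abs_wo w)" and lim: "\<forall>x\<in>#N. limit_part x = x"
  shows "(bits w M, bits w N) \<in> oexp2 w" and "bits w M \<noteq> bits w N"
proof -
  obtain l where l: "count M l < count N l" "\<And>k. l < k \<Longrightarrow> count M k = count N k"
    using multiset_less_top[OF MN(1)] by blast
  obtain i where i: "\<not> bit (count M l) i" "bit (count N l) i" "\<And>j. i < j \<Longrightarrow> bit (count M l) j = bit (count N l) j"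
    using nat_less_top_bit[OF l(1)] by blast
  have "limit_part l = l" using lim l(1) by (metis count_greater_zero_iff gr_zeroI not_less0)
  then obtain x where x: "x < abs_wo w" "limit_part x = l" "finite_part x = i"
    using exists_parts_below[OF MN(2) _ i(2)] by blast
  then obtain b where b: "b \<in> Field w" "x = pos w b" using pos_image[OF w] by blast
  have "b \<in> bits w N - bits w M" using b x i by (simp add: bits_def)
  moreover have "(a, b) \<in> w" if a: "a \<in> bits w M - bits w N" for a
  proof -
    let ?l = "limit_part (pos w a)" and ?i = "finite_part (pos w a)"
    have aw: "a \<in> Field w" and bit: "bit (count M ?l) ?i \<noteq> bit (count N ?l) ?i"
      using a by (auto simp: bits_def)
    then have "\<not> l < ?l" using l(2) by metis
    moreover have "\<not> i < ?i" if "?l = l" using i(3) bit that by metis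
    moreover have "?i \<noteq> i" if "?l = l" using a i that by (auto simp: bits_def)
    ultimately have "?l < limit_part x \<or> ?l = limit_part x \<and> ?i < finite_part x"
      using x by (metis linorder_less_linear)
    then have "pos w a < pos w b" using b parts_less by blast
    then show ?thesis using pos_le_iff[OF w aw b(1)] by (simp add: less_imp_le)
  qed
  ultimately show "(bits w M, bits w N) \<in> oexp2 w" "bits w M \<noteq> bits w N"
    using finite_bits[OF w] unfolding oexp2_def by (auto simp: bits_def)
qed

text \<open>The segment of \<open>oexp2 w\<close> below \<open>bits w M\<close> is used as the
  ordinal denoted by \<open>M\<close>; passing to a child lowers \<open>M\<close>, hence shortens
  the segment.\<close>

lemma rank_le_oexp2_initial_segment:
  fixes w :: "'n rel"
  assumes \<rho>: "is_rank_fun (Bad P l) child \<rho>" and w: "Well_order w"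
    and "otype_le l C M" "M < pow2 (abs_wo w)" "s \<in> Bad P l" "residual P l s = C"
  shows "\<rho> s \<le>o Restr (oexp2 w) (underS (oexp2 w) (bits w M))"
  using assms(3-)
proof (induction arbitrary: s)
  case (otype_leI M C)
  note W = Well_order_oexp2(1)[OF w]
  show ?case
  proof (rule is_rank_fun_least[OF \<rho> otype_leI.prems(2) Well_order_Restr[OF W]])
    fix t assume t: "t \<in> Bad P l" "child s t"
    then obtain S where S: "t = s @ [S]" by (auto simp: child_def)
    then have "S \<in> C" using t otype_leI.prems by (simp add: snoc_in_Bad_iff)
    then obtain M' where M': "M' < M"
      and IH: "M' < pow2 (abs_wo w) \<Longrightarrow> residual P l t = {T \<in> C. \<not> l S T} \<Longrightarrow>
        \<rho> t \<le>o Restr (oexp2 w) (underS (oexp2 w) (bits w M'))"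
      using otype_leI.IH t(1) by blast
    have "\<rho> t \<le>o Restr (oexp2 w) (underS (oexp2 w) (bits w M'))"
      by (rule IH) (use M' otype_leI.prems S in \<open>auto simp: residual_snoc\<close>)
    moreover have "Restr (oexp2 w) (underS (oexp2 w) (bits w M')) <o Restr (oexp2 w) (underS (oexp2 w) (bits w M))"
      by (rule Restr_underS_less[OF W]) (use bits_strict_mono[OF w M' otype_leI.prems(1)] otype_leI.hyps in auto)
    ultimately show "\<rho> t <o Restr (oexp2 w) (underS (oexp2 w) (bits w M))" by (rule ordLeq_ordLess_trans)
  qed
qed

text \<open>The root is separate because its bound is all of \<open>oexp2 w\<close> and not a proper
  segment; after one step the multiset is below \<open>pow2 (abs_wo w)\<close>.\<close>

lemma rank_le_oexp2:
  fixes w :: "'n rel"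
  assumes \<rho>: "is_rank_fun (Bad P l) child \<rho>" and w: "Well_order w"
    and P: "otype_le l P (pow2 (abs_wo w))"
  shows "\<rho> [] \<le>o oexp2 w"
proof (rule is_rank_fun_least[OF \<rho> Nil_in_Bad Well_order_oexp2(1)[OF w]])
  note W = Well_order_oexp2(1)[OF w]
  fix t assume t: "t \<in> Bad P l" "child [] t"
  then obtain S where S: "t = [] @ [S]" by (auto simp: child_def)
  then have "S \<in> P" using t snoc_in_Bad_iff[of "[]" S] by simp
  then obtain M where M: "M < pow2 (abs_wo w)" "otype_le l {T \<in> P. \<not> l S T} M"
    using otype_le_step[OF P] by blast
  have "\<rho> t \<le>o Restr (oexp2 w) (underS (oexp2 w) (bits w M))"
    by (rule rank_le_oexp2_initial_segment[OF \<rho> w M(2,1) t(1)]) (simp add: S residual_def)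
  moreover have "Restr (oexp2 w) (underS (oexp2 w) (bits w M)) <o oexp2 w"
    by (rule underS_Restr_ordLess[OF W]) (auto simp: Well_order_oexp2(2)[OF w])
  ultimately show "\<rho> t <o oexp2 w" by (rule ordLeq_ordLess_trans)
qed

section \<open>The lower bound via singletons\<close>

lemma Well_order_one_plus:
  assumes w: "Well_order w"
  shows "Well_order (one_plus w)" and "Field (one_plus w) = insert (Inl ()) (Inr ` Field w)"
proof -
  let ?\<phi> = "\<lambda>x. case x of Inl _ \<Rightarrow> None | Inr a \<Rightarrow> Some (pos w a)" and ?F = "insert (Inl ()) (Inr ` Field w)"
  have "inj_on ?\<phi> ?F" using pos_inj[OF w] by (auto simp: inj_on_def)
  moreover have "one_plus w = {(x, y). x \<in> ?F \<and> y \<in> ?F \<and> ?\<phi> x \<le> ?\<phi> y}"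
  proof (rule set_eqI)
    fix p
    have "w \<subseteq> Field w \<times> Field w" by (auto intro: FieldI1 FieldI2)
    then show "p \<in> one_plus w \<longleftrightarrow> p \<in> {(x, y). x \<in> ?F \<and> y \<in> ?F \<and> ?\<phi> x \<le> ?\<phi> y}"
      using pos_le_iff[OF w] by (cases p) (auto simp: one_plus_def)
  qed
  ultimately show "Well_order (one_plus w)" "Field (one_plus w) = ?F"
    by (rule Well_order_inj_wellorder)+
qed

lemma one_plus_mono:
  assumes "r \<le>o s"
  shows "one_plus r \<le>o one_plus s"
proof -
  have r: "Well_order r" and s: "Well_order s" using assms ordLeq_Well_order_simp by blast+
  obtain f where f: "embed r s f" using assms by (auto simp: ordLeq_def)
  have inj: "inj_on f (Field r)" by (rule embed_inj_on[OF r f])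
  have compat: "(f a, f b) \<in> s" if "(a, b) \<in> r" for a b
    using that embed_compat[OF f] by (auto simp: compat_def)
  have fF: "f ` Field r \<subseteq> Field s" by (rule embed_Field[OF f])
  show ?thesis
  proof (rule strict_mono_imp_ordLeq[OF Well_order_one_plus(1)[OF r] Well_order_one_plus(1)[OF s]])
    show "map_sum id f p \<in> Field (one_plus s)" if "p \<in> Field (one_plus r)" for p
      using that fF by (auto simp: Well_order_one_plus(2) r s)
    show "(map_sum id f p, map_sum id f q) \<in> one_plus s \<and> map_sum id f p \<noteq> map_sum id f q"
      if pq: "(p, q) \<in> one_plus r" "p \<noteq> q" for p q
    proof -
      from pq consider a where "a \<in> Field r" "p = Inl ()" "q = Inr a"
        | a b where "(a, b) \<in> r" "a \<noteq> b" "p = Inr a" "q = Inr b"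
        unfolding one_plus_def by blast
      then show ?thesis
      proof cases
        case 1 then show ?thesis using fF by (auto simp: one_plus_def)
      next
        case 2
        then have "f a \<noteq> f b" using inj by (meson FieldI1 FieldI2 inj_onD)
        then show ?thesis using 2 compat by (simp add: one_plus_def)
      qed
    qed
  qed
qed

lemma Restr_one_plus_Inr:
  assumes "Well_order w" "a \<in> Field w"
  shows "Restr (one_plus w) (underS (one_plus w) (Inr a)) = one_plus (Restr w (underS w a))"
proof -
  have "Refl w" using assms(1) by (simp add: order_on_defs)
  then have F: "Field (Restr w (underS w a)) = underS w a"
    by (rule Refl_Field_Restr2) (auto simp: underS_def Field_def)
  have "underS (one_plus w) (Inr a) = insert (Inl ()) (Inr ` underS w a)"
    using assms(2) by (auto simp: underS_def one_plus_def)
  moreover have "underS w a \<subseteq> Field w" by (auto simp: underS_def Field_def)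
  ultimately show ?thesis by (auto simp: one_plus_def F)
qed

text \<open>Since the empty set lies below every set, it can only close a bad sequence: it provides the
  additional step accounted for by the summand 1.\<close>

lemma one_plus_rank_le:
  assumes \<rho>: "is_rank_fun (Bad A le) child \<rho>" and \<rho>': "is_rank_fun (Bad (Pf A) (hoare le)) child \<rho>'"
    and "s \<in> Bad A le"
  shows "one_plus (\<rho> s) \<le>o \<rho>' (map (\<lambda>x. {x}) s)"
  using assms(3)
proof (induction "abs_wo (\<rho> s)" arbitrary: s rule: less_induct)
  case less
  let ?N' = "Bad (Pf A) (hoare le)" and ?img = "map (\<lambda>x. {x})"
  have img: "?img t \<in> ?N'" if "t \<in> Bad A le" for t
    using that by (auto simp: Bad_def bad_seq_def Pf_def hoare_def)
  note s' = img[OF less.prems]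
  have W: "Well_order (\<rho> s)" by (rule is_rank_funD(1)[OF \<rho> less.prems])
  note W1 = Well_order_one_plus(1)[OF W]
  show ?case
  proof (rule ccontr)
    assume "\<not> ?thesis"
    then have "\<rho>' (?img s) <o one_plus (\<rho> s)"
      using ordLess_or_ordLeq[OF is_rank_funD(1)[OF \<rho>' s'] W1] by blast
    then obtain p where p: "p \<in> Field (one_plus (\<rho> s))"
      and iso: "\<rho>' (?img s) =o Restr (one_plus (\<rho> s)) (underS (one_plus (\<rho> s)) p)"
      using ordLess_iff_ordIso_Restr[OF W1 is_rank_funD(1)[OF \<rho>' s']] by blast
    from p consider "p = Inl ()" | a where "a \<in> Field (\<rho> s)" "p = Inr a"
      unfolding Well_order_one_plus(2)[OF W] by blast
    then show False
    proof cases
      case 1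
      then have "underS (one_plus (\<rho> s)) p = {}" by (auto simp: underS_def one_plus_def)
      with iso have empty: "\<rho>' (?img s) =o ({} :: (unit + 'a list) rel)" by simp
      \<comment> \<open>No singleton embeds into the empty set, so \<open>{}\<close> extends the
        image sequence and its rank cannot be zero.\<close>
      have bad: "?img s @ [{}] \<in> ?N'"
        using s' by (auto simp: snoc_in_Bad_iff residual_def Pf_def hoare_def)
      then have "\<rho>' (?img s @ [{}]) <o \<rho>' (?img s)"
        using is_rank_funD(2)[OF \<rho>' s'] by (simp add: child_def)
      then have "\<rho>' (?img s @ [{}]) <o ({} :: (unit + 'a list) rel)"
        using empty ordLess_ordIso_trans by blast
      then show False using ordLess_iff_ordIso_Restr[of "{} :: (unit + 'a list) rel"] is_rank_funD(1)[OF \<rho>' bad]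
        by (auto simp: ordLess_def)
    next
      case 2
      let ?w = "Restr (\<rho> s) (underS (\<rho> s) a)"
      have w: "Well_order ?w" "?w <o \<rho> s"
        using Well_order_Restr[OF W] underS_Restr_ordLess[OF W] 2(1) by auto
      \<comment> \<open>Otherwise \<open>?w\<close> would strictly bound the ranks of all children,
        and \<open>\<rho> s\<close> would be at most its own proper segment.\<close>
      have "\<exists>t\<in>Bad A le. child s t \<and> ?w \<le>o \<rho> t"
      proof (rule ccontr)
        assume "\<not> ?thesis"
        then have "\<rho> s \<le>o ?w"
          using is_rank_fun_least[OF \<rho> less.prems w(1)] ordLess_or_ordLeq[OF is_rank_funD(1)[OF \<rho>] w(1)] by blast
        then show False using w(2) not_ordLess_ordLeq by blast
      qed
      then obtain t where t: "t \<in> Bad A le" "child s t" "?w \<le>o \<rho> t" by blast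
      have ts: "\<rho> t <o \<rho> s" using is_rank_funD(2)[OF \<rho> less.prems] t by blast
      then have "abs_wo (\<rho> t) < abs_wo (\<rho> s)"
        using W is_rank_funD(1)[OF \<rho> t(1)] by (simp add: abs_wo_less_iff)
      note IH = less.hyps[OF this t(1)]
      \<comment> \<open>The chain runs from the rank of the image of \<open>s\<close> through 1 +
        \<open>?w\<close>, 1 + \<open>\<rho> t\<close> and the rank of the image of
        \<open>t\<close>, and returns strictly above its start.\<close>
      note iso[unfolded 2(2) Restr_one_plus_Inr[OF W 2(1)]]
      also have "one_plus ?w \<le>o one_plus (\<rho> t)" by (rule one_plus_mono[OF t(3)])
      also note IH
      also have "\<rho>' (?img t) <o \<rho>' (?img s)"
        using is_rank_funD(2)[OF \<rho>' s' img[OF t(1)]] t(2) by (auto simp: child_def)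
      finally show False using ordLess_irreflexive by blast
    qed
  qed
qed

theorem mainTheorem1:
  fixes A :: "'a set" and le :: "'a \<Rightarrow> 'a \<Rightarrow> bool"
  assumes "wqo_on A le"
  shows "(one_plus (max_otype A le), max_otype (Pf A) (hoare le)) \<in> ordLeq
       \<and> (max_otype (Pf A) (hoare le), oexp2 (max_otype A le)) \<in> ordLeq"
proof -
  have qo: "qo_on A le" and seq: "\<And>f :: nat \<Rightarrow> 'a. \<forall>i. f i \<in> A \<Longrightarrow> \<exists>i j. i < j \<and> le (f i) (f j)"
    using assms by (auto simp: wqo_on_def)
  let ?\<rho> = "node_rank (Bad A le) child"
  have \<rho>: "is_rank_fun (Bad A le) child ?\<rho>" by (rule is_rank_fun_node_rank[OF seq])
  interpret bad_rank A le "\<lambda>s. abs_wo (?\<rho> s)" by (rule bad_rank_abs_wo[OF \<rho> qo])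
  have P: "otype_le (hoare le) (Pf A) (pow2 (abs_wo (?\<rho> [])))"
    using otype_le_Pf_residual[of "[]"] by simp
  \<comment> \<open>The ordinal bound \<open>P\<close> itself supplies the absence of infinite bad
    sequences in \<open>Pf A\<close>.\<close>
  have \<rho>': "is_rank_fun (Bad (Pf A) (hoare le)) child (node_rank (Bad (Pf A) (hoare le)) child)"
    by (rule is_rank_fun_node_rank[OF otype_le_no_bad_sequence[OF P]])
  show ?thesis
    unfolding max_otype_def
    using one_plus_rank_le[OF \<rho> \<rho>' Nil_in_Bad] rank_le_oexp2[OF \<rho>' is_rank_funD(1)[OF \<rho> Nil_in_Bad] P]
    by simp
qed

end
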